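(* Any triangle $\vec z=(z_1,z_2,z_3)$ on the complex plane has unbalance factor $$K=\sqrt{\frac{1-\operatorname{sign}(\vec z)\sqrt{3-6q}}{1+\operatorname{sign}(\vec z)\sqrt{3-6q}}},$$ where $q$ is the quadrofactor of the triangle $\vec z$.
   Context: A triangle is any triple $\vec z=(z_1,z_2,z_3)$ of points of $\mathbb C$ (degenerate ones allowed). The unbalance factor of $\vec z$ is the ratio of the absolute values of its negative and positive components, $$K=\frac{\big|z_1+z_2e^{\frac{2\pi}3i}+z_3e^{-\frac{2\pi}3i}\big|}{\big|z_1+z_2e^{-\frac{2\pi}3i}+z_3e^{\frac{2\pi}3i}\big|}.$$ The quadrofactor of $\vec z$ is $$q=\frac{|z_1-z_2|^4+|z_2-z_3|^4+|z_3-z_1|^4}{\big(|z_1-z_2|^2+|z_2-z_3|^2+|z_3-z_1|^2\big)^2},$$ with the convention $q=\frac12$ if $z_1=z_2=z_3$. The triangle $\vec z$ is singular if $z_1=z_2=z_3$, and linear if there are pairwise distinct $i,j,k\in\{1,2,3\}$ with $|z_i-z_k|=|z_i-z_j|+|z_j-z_k|$. The orientation $\operatorname{sign}(\vec z)$ equals $-1$ if $\vec z$ is singular; $0$ if $\vec z$ is linear and not singular; $1$ if $\vec z$ is non-linear and oriented counter-clockwise; $-1$ if $\vec z$ is non-linear and oriented clockwise.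
   Formalization: For z1=z2=z3 the ratio defining K is 0/0 and the text gives no convention, so K is set to 1 there; K and the right-hand side take the value infinity when the denominator vanishes (clockwise equilateral triangles). *)

theory Defs
  imports "HOL-Analysis.Analysis"
begin

type_synonym triangle = "complex ^ 3"

definition singular :: "triangle \<Rightarrow> bool" where
  "singular z \<longleftrightarrow> z $ 1 = z $ 2 \<and> z $ 2 = z $ 3"

definition linear_triangle :: "triangle \<Rightarrow> bool" where
  "linear_triangle z \<longleftrightarrow> (\<exists>i j k. i \<noteq> j \<and> j \<noteq> k \<and> i \<noteq> k \<and>
     cmod (z $ i - z $ k) = cmod (z $ i - z $ j) + cmod (z $ j - z $ k))"

text \<open>Twice the signed area of the triangle, i.e. the determinant of the real
  vectors \<open>z\<^sub>2 - z\<^sub>1\<close> and \<open>z\<^sub>3 - z\<^sub>1\<close>, is positive.\<close>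

definition counterclockwise :: "triangle \<Rightarrow> bool" where
  "counterclockwise z \<longleftrightarrow> Im (cnj (z $ 2 - z $ 1) * (z $ 3 - z $ 1)) > 0"

text \<open>The signed area of a non-linear triangle is nonzero, so the last branch
  consists of the clockwise ones.\<close>

definition orientation :: "triangle \<Rightarrow> real" where
  "orientation z =
     (if singular z then -1
      else if linear_triangle z then 0
      else if counterclockwise z then 1
      else -1)"

definition quadrofactor :: "triangle \<Rightarrow> real" where
  "quadrofactor z =
     (if singular z then 1 / 2
      else (cmod (z $ 1 - z $ 2) ^ 4 + cmod (z $ 2 - z $ 3) ^ 4 + cmod (z $ 3 - z $ 1) ^ 4)
           / ((cmod (z $ 1 - z $ 2))\<^sup>2 + (cmod (z $ 2 - z $ 3))\<^sup>2 + (cmod (z $ 3 - z $ 1))\<^sup>2)\<^sup>2)"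

text \<open>The unbalance factor takes values in \<open>[0, \<infinity>]\<close>: it is \<open>\<infinity>\<close> for the clockwise
  equilateral triangles, whose denominator vanishes (in \<^typ>\<open>ereal\<close>,
  \<open>a / 0 = \<infinity>\<close> for \<open>a > 0\<close>). Numerator and denominator vanish simultaneously exactly
  for the singular triangles; there \<open>0 / 0\<close> is read as \<open>1\<close>, the value which
  matches the convention \<open>q = 1 / 2\<close>.\<close>

definition unbalance_factor :: "triangle \<Rightarrow> ereal" where
  "unbalance_factor z =
     (if singular z then 1
      else ereal (cmod (z $ 1 + z $ 2 * exp (2 * pi / 3 * \<i>) + z $ 3 * exp (- (2 * pi / 3) * \<i>)))
         / ereal (cmod (z $ 1 + z $ 2 * exp (- (2 * pi / 3) * \<i>) + z $ 3 * exp (2 * pi / 3 * \<i>))))"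

definition ereal_sqrt :: "ereal \<Rightarrow> ereal" where
  "ereal_sqrt x = (if \<bar>x\<bar> = \<infinity> then x else ereal (sqrt (real_of_ereal x)))"

end

theory Submission
  imports Defs
begin

text \<open>
  For a non-singular triangle, let \<open>S\<close> be the sum of the squared side lengths, \<open>Q\<close> the sum of their fourth powers and \<open>D\<close> twice
  the signed area. Expanding squared moduli, the negative and positive components of the triangle
  satisfy \<open>N\<^sup>2 = S/2 - \<surd>3 D\<close> and \<open>P\<^sup>2 = S/2 + \<surd>3 D\<close>: the two components see the same side lengths and
  differ only by the sense of rotation. Hence, with \<open>t = 2 \<surd>3 D / S\<close>,
  \<open>K\<^sup>2 = N\<^sup>2/P\<^sup>2 = (1 - t)/(1 + t)\<close>.

  The quadrofactor determines \<open>t\<close> up to sign by Heron's formula \<open>4 D\<^sup>2 = S\<^sup>2 - 2 Q\<close>, which gives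
  \<open>3 - 6 q = 3 (S\<^sup>2 - 2 Q)/S\<^sup>2 = t\<^sup>2\<close>. The missing sign is the orientation. That it vanishes exactly when
  \<open>D = 0\<close> follows from Heron's formula in its factored form
  \<open>4 D\<^sup>2 = (a + b + c)(b + c - a)(a + c - b)(a + b - c)\<close> for the side lengths \<open>a\<close>, \<open>b\<close>, \<open>c\<close>: the first
  factor is positive, and the other three vanish precisely in the three linear configurations.
  Singular triangles have \<open>K = 1\<close> and \<open>q = 1/2\<close> by convention, so both sides are \<open>1\<close>.
\<close>

definition double_signed_area :: "triangle \<Rightarrow> real" where
  "double_signed_area z = Im (cnj (z $ 2 - z $ 1) * (z $ 3 - z $ 1))"

definition sum_side_squares :: "triangle \<Rightarrow> real" where
  "sum_side_squares z =
     (cmod (z $ 1 - z $ 2))\<^sup>2 + (cmod (z $ 2 - z $ 3))\<^sup>2 + (cmod (z $ 3 - z $ 1))\<^sup>2"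

definition sum_side_fourth_powers :: "triangle \<Rightarrow> real" where
  "sum_side_fourth_powers z =
     cmod (z $ 1 - z $ 2) ^ 4 + cmod (z $ 2 - z $ 3) ^ 4 + cmod (z $ 3 - z $ 1) ^ 4"

lemma sum_side_squares_pos:
  assumes "\<not> singular z"
  shows "sum_side_squares z > 0"
proof -
  have "z $ 1 - z $ 2 \<noteq> 0 \<or> z $ 2 - z $ 3 \<noteq> 0"
    using assms by (auto simp: singular_def)
  then show ?thesis
    unfolding sum_side_squares_def
    by (elim disjE) (simp_all add: add_pos_nonneg add_nonneg_pos)
qed

lemma heron_power_sums:
  "4 * (double_signed_area z)\<^sup>2 = (sum_side_squares z)\<^sup>2 - 2 * sum_side_fourth_powers z"
proof -
  have fourth: "x ^ 4 = (x\<^sup>2)\<^sup>2" for x :: real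
    by simp
  show ?thesis
    unfolding double_signed_area_def sum_side_squares_def sum_side_fourth_powers_def fourth cmod_power2
    by (simp add: power2_eq_square algebra_simps)
qed

lemma heron_factored:
  fixes z :: triangle
  defines "a \<equiv> cmod (z $ 1 - z $ 2)" and "b \<equiv> cmod (z $ 2 - z $ 3)" and "c \<equiv> cmod (z $ 3 - z $ 1)"
  shows "4 * (double_signed_area z)\<^sup>2 = (a + b + c) * (b + c - a) * (a + c - b) * (a + b - c)"
  unfolding heron_power_sums sum_side_squares_def sum_side_fourth_powers_def a_def b_def c_def
  by (simp add: power2_eq_square power4_eq_xxxx algebra_simps)

lemma linear_triangle_iff_side_sum:
  fixes z :: triangle
  defines "a \<equiv> cmod (z $ 1 - z $ 2)" and "b \<equiv> cmod (z $ 2 - z $ 3)" and "c \<equiv> cmod (z $ 3 - z $ 1)"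
  shows "linear_triangle z \<longleftrightarrow> a = b + c \<or> b = a + c \<or> c = a + b"
proof -
  have exists_3: "(\<exists>i. P i) \<longleftrightarrow> P 1 \<or> P 2 \<or> P 3" for P :: "3 \<Rightarrow> bool"
    by (metis exhaust_3)
  have flip: "cmod (z $ 2 - z $ 1) = a" "cmod (z $ 3 - z $ 2) = b" "cmod (z $ 1 - z $ 3) = c"
    by (simp_all add: a_def b_def c_def norm_minus_commute)
  show ?thesis
    unfolding linear_triangle_def exists_3
    by (simp add: flip a_def[symmetric] b_def[symmetric] c_def[symmetric]) argo
qed

lemma linear_triangle_iff_double_signed_area:
  assumes "\<not> singular z"
  shows "linear_triangle z \<longleftrightarrow> double_signed_area z = 0"
proof -
  let ?a = "cmod (z $ 1 - z $ 2)" and ?b = "cmod (z $ 2 - z $ 3)" and ?c = "cmod (z $ 3 - z $ 1)"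
  have "?a > 0 \<or> ?b > 0"
    using assms by (auto simp: singular_def)
  then have "?a + ?b + ?c \<noteq> 0"
    using norm_ge_zero[of "z $ 1 - z $ 2"] norm_ge_zero[of "z $ 2 - z $ 3"]
      norm_ge_zero[of "z $ 3 - z $ 1"] by linarith
  moreover have "double_signed_area z = 0 \<longleftrightarrow> 4 * (double_signed_area z)\<^sup>2 = 0"
    by simp
  ultimately show ?thesis
    unfolding linear_triangle_iff_side_sum heron_factored by auto
qed

lemma orientation_eq_sgn:
  assumes "\<not> singular z"
  shows "orientation z = sgn (double_signed_area z)"
  using assms linear_triangle_iff_double_signed_area[OF assms]
  by (auto simp: orientation_def counterclockwise_def double_signed_area_def sgn_real_def)

text \<open>By Heron's formula the radicand is the square of the right-hand side, and the orientation
  restores the sign lost by taking the square root.\<close>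

lemma orientation_sqrt_quadrofactor:
  assumes "\<not> singular z"
  shows "orientation z * sqrt (3 - 6 * quadrofactor z)
    = 2 * sqrt 3 * double_signed_area z / sum_side_squares z"
proof -
  let ?D = "double_signed_area z" and ?S = "sum_side_squares z" and ?Q = "sum_side_fourth_powers z"
  have S: "?S > 0"
    using assms by (rule sum_side_squares_pos)
  have "quadrofactor z = ?Q / ?S\<^sup>2"
    using assms by (simp add: quadrofactor_def sum_side_squares_def sum_side_fourth_powers_def)
  then have "3 - 6 * quadrofactor z = 3 * (?S\<^sup>2 - 2 * ?Q) / ?S\<^sup>2"
    using S by (simp add: field_simps)
  also have "\<dots> = 12 * ?D\<^sup>2 / ?S\<^sup>2"
    by (simp add: heron_power_sums[symmetric])
  also have "\<dots> = (2 * sqrt 3 * \<bar>?D\<bar> / ?S)\<^sup>2"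
    by (simp add: power_mult_distrib power_divide)
  finally have "sqrt (3 - 6 * quadrofactor z) = 2 * sqrt 3 * \<bar>?D\<bar> / ?S"
    using S by (simp add: real_sqrt_unique)
  then show ?thesis
    using orientation_eq_sgn[OF assms] by (simp add: sgn_mult_abs mult.left_commute)
qed

lemma exp_third_turn:
  "exp (2 * pi / 3 * \<i>) = Complex (- 1 / 2) (sqrt 3 / 2)"
  "exp (- (2 * pi / 3) * \<i>) = Complex (- 1 / 2) (- sqrt 3 / 2)"
proof -
  have "exp (2 * pi / 3 * \<i>) = cis (2 * pi / 3)" "exp (- (2 * pi / 3) * \<i>) = cis (- (2 * pi / 3))"
    by (simp_all add: cis_conv_exp mult.commute)
  then show "exp (2 * pi / 3 * \<i>) = Complex (- 1 / 2) (sqrt 3 / 2)"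
    "exp (- (2 * pi / 3) * \<i>) = Complex (- 1 / 2) (- sqrt 3 / 2)"
    by (simp_all add: complex_eq_iff cos_120 sin_120)
qed

text \<open>The cross terms of the expanded squared modulus carry the factors \<open>cos (2\<pi>/3) = -1/2\<close>, which
  assemble \<open>S/2\<close>, and \<open>sin (\<plusminus>2\<pi>/3)\<close>, which multiply the pairwise cross products whose sum is \<open>D\<close>.
  Stating both components at once, with \<open>s = \<plusminus>\<surd>3\<close>, shows that they differ only in the sign of \<open>s\<close>.\<close>

lemma cmod_component_squared:
  assumes "s\<^sup>2 = 3"
  shows "(cmod (z $ 1 + z $ 2 * Complex (- 1 / 2) (s / 2) + z $ 3 * Complex (- 1 / 2) (- s / 2)))\<^sup>2
    = sum_side_squares z / 2 - s * double_signed_area z"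
proof -
  have s: "s * s = 3" "\<And>x. s * (s * x) = 3 * x"
    using assms by (simp_all add: power2_eq_square mult.assoc[symmetric])
  show ?thesis
    unfolding sum_side_squares_def double_signed_area_def cmod_power2
    by (simp add: power2_eq_square field_simps s)
qed

text \<open>The case \<open>m = 0\<close>, where both sides are infinite, is what covers the clockwise equilateral
  triangles.\<close>

lemma ereal_divide_eq_ereal_sqrt:
  fixes m n c :: real
  assumes "m \<ge> 0" "n \<ge> 0" "c > 0" "m \<noteq> 0 \<or> n \<noteq> 0"
  shows "ereal n / ereal m = ereal_sqrt (ereal (c * n\<^sup>2) / ereal (c * m\<^sup>2))"
proof (cases "m = 0")
  case True
  then show ?thesis
    using assms by (simp add: ereal_sqrt_def)
next
  case False
  then show ?thesis
    using assms by (simp add: ereal_sqrt_def real_sqrt_divide)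
qed

theorem theorem9:
  fixes z :: triangle
  shows "unbalance_factor z =
    ereal_sqrt (ereal (1 - orientation z * sqrt (3 - 6 * quadrofactor z))
              / ereal (1 + orientation z * sqrt (3 - 6 * quadrofactor z)))"
proof (cases "singular z")
  case True
  then show ?thesis
    by (simp add: unbalance_factor_def quadrofactor_def ereal_sqrt_def one_ereal_def)
next
  case False
  let ?D = "double_signed_area z" and ?S = "sum_side_squares z"
  let ?n = "cmod (z $ 1 + z $ 2 * exp (2 * pi / 3 * \<i>) + z $ 3 * exp (- (2 * pi / 3) * \<i>))"
  let ?p = "cmod (z $ 1 + z $ 2 * exp (- (2 * pi / 3) * \<i>) + z $ 3 * exp (2 * pi / 3 * \<i>))"
  have S: "?S > 0"
    using False by (rule sum_side_squares_pos)
  have n: "?n\<^sup>2 = ?S / 2 - sqrt 3 * ?D"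
    unfolding exp_third_turn by (rule cmod_component_squared) simp
  have p: "?p\<^sup>2 = ?S / 2 + sqrt 3 * ?D"
    unfolding exp_third_turn using cmod_component_squared[of "- sqrt 3" z] by simp
  \<comment> \<open>The components do not vanish together, so the quotient is never \<open>0 / 0\<close>.\<close>
  have "?n\<^sup>2 + ?p\<^sup>2 = ?S"
    unfolding n p by simp
  then have "?p \<noteq> 0 \<or> ?n \<noteq> 0"
    using S by (metis add.right_neutral less_irrefl zero_power2)
  then have "ereal ?n / ereal ?p = ereal_sqrt (ereal (2 / ?S * ?n\<^sup>2) / ereal (2 / ?S * ?p\<^sup>2))"
    using S by (intro ereal_divide_eq_ereal_sqrt) auto
  moreover have "2 / ?S * ?n\<^sup>2 = 1 - orientation z * sqrt (3 - 6 * quadrofactor z)"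
    unfolding n orientation_sqrt_quadrofactor[OF False] using S by (simp add: field_simps)
  moreover have "2 / ?S * ?p\<^sup>2 = 1 + orientation z * sqrt (3 - 6 * quadrofactor z)"
    unfolding p orientation_sqrt_quadrofactor[OF False] using S by (simp add: field_simps)
  ultimately show ?thesis
    using False by (simp only: unbalance_factor_def if_False)
qed

end
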